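(* Speculation could be unprofitable in first-price auctions: there exist a number of sellers $N\ge2$, a reserve price $r\in(0,1]$ and a value distribution $F$ as in the context such that $\Pi^\star(v)\le 0$ for all $v\in[0,r]$, i.e. no offer $p\in[0,r]$ gives the speculator a positive expected profit in a symmetric equilibrium of the first-price-auction (FPA) speculation game.
   Context: Setting. $N\ge2$ sellers each own one item; their private values are drawn independently from a CDF $F$ on $[0,1]$ with a density, $F(0)=0<F(v)$ for $v\in(0,1]$ and $F(v)<1$ for $v<1$. An auctioneer buys one item by a reverse first-price sealed-bid auction with reserve $r\in(0,1]$: the lowest bid not exceeding $r$ wins and the winner is paid his own bid. A speculator (value $0$ for items) first offers every seller a price $p\in[0,r]$; sellers simultaneously accept or reject; then the number of sellers in the auction and whether the speculator participates are announced, and the auction is held among the sellers who rejected and the speculator (if he acquired at least one item). Bidders never bid below their values. In any symmetric perfect Bayesian equilibrium sellers accept iff their value is below a cutoff $v^\star\in[0,r]$. For $F(v)<1$ let $G(b;v)=\frac{F(b)-F(v)}{1-F(v)}$ for $b\in[v,1]$ and $$\underline b(m,v)=\max_{v\le b\le r}b\,[1-G(b;v)]^m$$ (with $\underline b(m,r)=r$). The offer inducing cutoff $v$ is $$p^\star(v)=v+\int_v^r[1-F(x)]^{N-1}dx+\sum_{m=0}^{N-2}\binom{N-1}{m}[1-F(v)]^m[F(v)]^{N-1-m}\big[\underline b(m+1,v)-v\big],$$ and the speculator's expected profit at cutoff $v$, in any symmetric equilibrium, is $$\Pi^\star(v)=\sum_{m=1}^{N-1}\binom Nm[1-F(v)]^m[F(v)]^{N-m}\,\underline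 b(m,v)+[F(v)]^N r-N F(v)\,p^\star(v).$$ Offers below $p^\star(0)$ are never accepted and yield profit $0$. *)

theory Defs
  imports "HOL-Probability.Probability"
begin

definition value_cdf :: "(real \<Rightarrow> real) \<Rightarrow> bool" where
  "value_cdf F \<longleftrightarrow>
     (\<exists>f :: real \<Rightarrow> real. f \<in> borel_measurable borel \<and> (\<forall>x. 0 \<le> f x) \<and>
        prob_space (density lborel (\<lambda>x. ennreal (f x))) \<and>
        F = cdf (density lborel (\<lambda>x. ennreal (f x)))) \<and>
     F 0 = 0 \<and> F 1 = 1 \<and> (\<forall>v\<in>{0<..1}. 0 < F v) \<and> (\<forall>v<1. F v < 1)"

definition cond_cdf :: "(real \<Rightarrow> real) \<Rightarrow> real \<Rightarrow> real \<Rightarrow> real" where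
  "cond_cdf F v b = (F b - F v) / (1 - F v)"

text \<open>
  For \<open>m\<close> rejecting sellers and cutoff \<open>v\<close>, this is the maximum over \<open>b \<in> [v, r]\<close> of
  \<open>b [1 - G(b; v)] ^ m\<close>. The supremum is attained because \<open>F\<close> is continuous; see
  \<open>low_bid_attained\<close> below. The case \<open>v = r\<close> is a separate convention since
  \<open>G\<close> is undefined when \<open>r = 1\<close> and \<open>F 1 = 1\<close>.
\<close>
definition low_bid :: "(real \<Rightarrow> real) \<Rightarrow> real \<Rightarrow> nat \<Rightarrow> real \<Rightarrow> real" where
  "low_bid F r m v =
     (if v = r then r else (SUP b\<in>{v..r}. b * (1 - cond_cdf F v b) ^ m))"

definition offer_price :: "nat \<Rightarrow> real \<Rightarrow> (real \<Rightarrow> real) \<Rightarrow> real \<Rightarrow> real" where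
  "offer_price N r F v =
     v + integral {v..r} (\<lambda>x. (1 - F x) ^ (N - 1)) +
     (\<Sum>m=0..N-2. real ((N - 1) choose m) * (1 - F v) ^ m * F v ^ (N - 1 - m) *
        (low_bid F r (m + 1) v - v))"

definition speculator_profit :: "nat \<Rightarrow> real \<Rightarrow> (real \<Rightarrow> real) \<Rightarrow> real \<Rightarrow> real" where
  "speculator_profit N r F v =
     (\<Sum>m=1..N-1. real (N choose m) * (1 - F v) ^ m * F v ^ (N - m) * low_bid F r m v) +
     F v ^ N * r - real N * F v * offer_price N r F v"

text \<open>
  \<open>offer_profit N r F p y\<close>: the offer \<open>p\<close> gives the speculator the expected profit \<open>y\<close> in a
  symmetric equilibrium. It is a relation so that no injectivity of \<open>offer_price\<close> in the
  cutoff is presupposed.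
\<close>
inductive offer_profit :: "nat \<Rightarrow> real \<Rightarrow> (real \<Rightarrow> real) \<Rightarrow> real \<Rightarrow> real \<Rightarrow> bool"
  for N :: nat and r :: real and F :: "real \<Rightarrow> real" where
  never_accepted: "p < offer_price N r F 0 \<Longrightarrow> offer_profit N r F p 0"
| accepted_below_cutoff: "v \<in> {0..r} \<Longrightarrow> p = offer_price N r F v \<Longrightarrow>
    offer_profit N r F p (speculator_profit N r F v)"

lemma value_cdf_continuous:
  assumes "value_cdf F"
  shows "continuous_on A F"
proof -
  obtain f :: "real \<Rightarrow> real" where f: "f \<in> borel_measurable borel"
    and ps: "prob_space (density lborel (\<lambda>x. ennreal (f x)))"
    and F: "F = cdf (density lborel (\<lambda>x. ennreal (f x)))"
    using assms unfolding value_cdf_def by blast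
  define M where "M = density lborel (\<lambda>x. ennreal (f x))"
  interpret finite_borel_measure M
    using ps unfolding M_def finite_borel_measure_def finite_borel_measure_axioms_def
    by (auto simp: prob_space_def)
  have "measure M {x} = 0" for x
  proof -
    have "AE y in lborel. y \<notin> {x}"
      by (intro AE_not_in) (simp add: null_sets_def)
    then have "AE y in lborel. y \<in> {x} \<longrightarrow> ennreal (f y) = 0"
      by (rule eventually_mono) blast
    then have "{x} \<in> null_sets M"
      unfolding M_def using f by (subst null_sets_density_iff) simp_all
    then show ?thesis
      by (simp add: measure_eq_0_null_sets)
  qed
  then show ?thesis
    unfolding F M_def[symmetric] by (simp add: continuous_at_imp_continuous_on isCont_cdf)
qed

lemma low_bid_attained:
  assumes "value_cdf F" "v < r" "r \<le> 1"
  shows "\<exists>b\<in>{v..r}. low_bid F r m v = b * (1 - cond_cdf F v b) ^ m \<and>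
    (\<forall>b'\<in>{v..r}. b' * (1 - cond_cdf F v b') ^ m \<le> low_bid F r m v)"
proof -
  let ?h = "\<lambda>b. b * (1 - cond_cdf F v b) ^ m"
  have "F v < 1"
    using assms unfolding value_cdf_def by auto
  then have "continuous_on {v..r} ?h"
    unfolding cond_cdf_def
    by (intro continuous_intros value_cdf_continuous[OF assms(1)]) auto
  then obtain b where b: "b \<in> {v..r}" "\<And>b'. b' \<in> {v..r} \<Longrightarrow> ?h b' \<le> ?h b"
    using continuous_attains_sup[of "{v..r}" ?h] assms(2) by force
  then have "(SUP b\<in>{v..r}. ?h b) = ?h b"
    by (intro cSup_eq_maximum) auto
  then show ?thesis
    using b assms(2) unfolding low_bid_def by auto
qed

end

theory Submission
  imports Defs
begin

text \<open>
  Two sellers with uniform values and reserve \<open>1/2\<close> suffice. Since \<open>b (1 - b) \<le> 1/4\<close>, the lowest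
  bid \<open>L\<close> against one rejecting seller satisfies \<open>(1 - v) L \<le> 1/4\<close>. It enters the profit with
  coefficient \<open>2 v (1 - 2 v) \<le> 2 v (1 - v)\<^sup>2\<close>, so the profit is at most
  \<open>v (v\<^sup>2 - 1/4) \<le> 0\<close> for \<open>v \<le> 1/2\<close>.
\<close>

text \<open>Clamped, since \<open>value_cdf\<close> asks for equality with a \<open>cdf\<close> on
  the whole real line, not only on [0, 1].\<close>

definition uniform_cdf :: "real \<Rightarrow> real" where
  "uniform_cdf x = max 0 (min 1 x)"

lemma uniform_cdf_eq: "x \<in> {0..1} \<Longrightarrow> uniform_cdf x = x"
  by (simp add: uniform_cdf_def)

lemma value_cdf_uniform: "value_cdf uniform_cdf"
proof -
  let ?f = "indicator {0..1} :: real \<Rightarrow> real"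
  let ?M = "density lborel (\<lambda>x. ennreal (?f x))"
  have em: "emeasure ?M A = emeasure lborel ({0..1} \<inter> A)" if "A \<in> sets borel" for A
    using that
    by (subst emeasure_density) (simp_all add: ennreal_indicator flip: indicator_inter_arith)
  have "prob_space ?M"
    by (rule prob_spaceI) (simp add: em)
  moreover have "cdf ?M x = uniform_cdf x" for x
  proof -
    \<comment> \<open>For x < 0 both sides are empty, which matches the clamp at 0.\<close>
    have "{0..1} \<inter> {..x} = {0..min 1 x}"
      by auto
    then show ?thesis
      by (simp add: cdf_def measure_def em uniform_cdf_def max_def min_def)
  qed
  ultimately show ?thesis
    unfolding value_cdf_def
    by (intro conjI exI[of _ ?f]) (auto simp: uniform_cdf_def fun_eq_iff)
qed

text \<open>Under uniform values 1 - G(b; v) = (1 - b) / (1 - v), so the objective is b (1 - b) / (1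
  - v). At v = 1/2 the convention \<open>low_bid\<close> = r gives equality.\<close>

lemma low_bid_uniform_le:
  assumes "v \<in> {0..1/2}"
  shows "(1 - v) * low_bid uniform_cdf (1/2) 1 v \<le> 1/4"
proof (cases "v = 1/2")
  case True
  then show ?thesis
    by (simp add: low_bid_def)
next
  case False
  then have v: "0 \<le> v" "v < 1/2"
    using assms by auto
  have "b * (1 - cond_cdf uniform_cdf v b) ^ 1 \<le> 1 / (4 * (1 - v))" if "b \<in> {v..1/2}" for b
  proof -
    have "1 - cond_cdf uniform_cdf v b = (1 - b) / (1 - v)"
      using that v by (simp add: cond_cdf_def uniform_cdf_eq field_simps)
    then have "b * (1 - cond_cdf uniform_cdf v b) ^ 1 = b * (1 - b) / (1 - v)"
      by simp
    also have "b * (1 - b) \<le> 1/4"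
      using zero_le_power2[of "b - 1/2"] by (simp add: power2_eq_square algebra_simps)
    then have "b * (1 - b) / (1 - v) \<le> (1/4) / (1 - v)"
      using v by (intro divide_right_mono) auto
    finally show ?thesis
      by simp
  qed
  then have "low_bid uniform_cdf (1/2) 1 v \<le> 1 / (4 * (1 - v))"
    using v False unfolding low_bid_def by (auto intro!: cSUP_least)
  then show ?thesis
    using v by (simp add: field_simps)
qed

lemma integral_uniform_tail:
  assumes "v \<in> {0..1/2}"
  shows "integral {v..1/2} (\<lambda>x. 1 - uniform_cdf x) = 3/8 - v + v\<^sup>2 / 2"
proof -
  have "((\<lambda>x. 1 - x) has_integral ((1/2 - (1/2)\<^sup>2 / 2) - (v - v\<^sup>2 / 2))) {v..1/2}"
    using assms
    by (intro fundamental_theorem_of_calculus)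
       (auto simp flip: has_real_derivative_iff_has_vector_derivative intro!: derivative_eq_intros)
  then have "integral {v..1/2} (\<lambda>x. 1 - x) = 3/8 - v + v\<^sup>2 / 2"
    by (simp add: integral_unique power2_eq_square)
  moreover have "integral {v..1/2} (\<lambda>x. 1 - uniform_cdf x) = integral {v..1/2} (\<lambda>x. 1 - x)"
    using assms by (intro integral_cong) (simp add: uniform_cdf_eq)
  ultimately show ?thesis
    by simp
qed

lemma speculator_profit_uniform_nonpos:
  assumes v: "v \<in> {0..1/2}"
  shows "speculator_profit 2 (1/2) uniform_cdf v \<le> 0"
proof -
  define L where "L = low_bid uniform_cdf (1/2) 1 v"
  have F: "uniform_cdf v = v"
    using v by (simp add: uniform_cdf_eq)
  have "0 \<le> v" "v \<le> 1/2"
    using v by auto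
  have profit: "speculator_profit 2 (1/2) uniform_cdf v =
      2 * v * ((1 - 2 * v) * L + v / 4 - 3/8 + v\<^sup>2 / 2)"
    by (simp add: speculator_profit_def offer_price_def F integral_uniform_tail[OF v] L_def)
       (simp add: power2_eq_square algebra_simps)
  have le: "(1 - v) * L \<le> 1/4"
    unfolding L_def using v by (rule low_bid_uniform_le)
  have "(1 - 2 * v) * L \<le> (1 - v) / 4"
  proof (cases "0 \<le> L")
    case True
    then have "(1 - 2 * v) * L \<le> (1 - v)\<^sup>2 * L"
      by (intro mult_right_mono) (simp_all add: power2_eq_square algebra_simps)
    also have "\<dots> \<le> (1 - v) * (1/4)"
      using mult_left_mono[OF le, of "1 - v"] \<open>v \<le> 1/2\<close>
      by (simp add: power2_eq_square mult.assoc)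
    finally show ?thesis
      by simp
  next
    case False
    then have "(1 - 2 * v) * L \<le> 0"
      using \<open>v \<le> 1/2\<close> by (intro mult_nonneg_nonpos) auto
    then show ?thesis
      by (rule order_trans) (use \<open>v \<le> 1/2\<close> in simp)
  qed
  moreover have "v\<^sup>2 \<le> (1/2)\<^sup>2"
    using \<open>0 \<le> v\<close> \<open>v \<le> 1/2\<close> by (intro power_mono)
  then have "v\<^sup>2 \<le> 1/4"
    by (simp add: power2_eq_square)
  ultimately have "(1 - 2 * v) * L + v / 4 - 3/8 + v\<^sup>2 / 2 \<le> 0"
    by argo
  then show ?thesis
    unfolding profit using \<open>0 \<le> v\<close> by (intro mult_nonneg_nonpos) auto
qed

theorem proposition4:
  shows "\<exists>(N::nat) (r::real) (F::real \<Rightarrow> real).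
    2 \<le> N \<and> 0 < r \<and> r \<le> 1 \<and> value_cdf F \<and>
    (\<forall>v\<in>{0..r}. speculator_profit N r F v \<le> 0) \<and>
    (\<forall>p\<in>{0..r}. \<forall>y. offer_profit N r F p y \<longrightarrow> y \<le> 0)"
proof -
  \<comment> \<open>A rejected offer has y = 0; any other y is the profit at a cutoff.\<close>
  have "y \<le> 0" if "offer_profit 2 (1/2) uniform_cdf p y" for p y
    using that by cases (simp_all add: speculator_profit_uniform_nonpos)
  then show ?thesis
    using value_cdf_uniform speculator_profit_uniform_nonpos
    by (intro exI[of _ 2] exI[of _ "1/2"] exI[of _ uniform_cdf]) auto
qed

end
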